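(* Let $\{A,G,\sigma,\alpha\}$ be a crossed system. The center of the category crossed product $A \rtimes_{\alpha}^{\sigma} G$ equals the collection of elements $\sum_{e \in ob(G)} \sum_{s \in G_e} a_s u_s$ in $\sum_{e \in ob(G)} Z(A_e \rtimes_{\alpha_e}^{\sigma_e} G_e)$ (that is, with $\sum_{s\in G_e}a_su_s\in Z(A_e \rtimes_{\alpha_e}^{\sigma_e} G_e)$ for each $e\in ob(G)$) satisfying $$\sum_{s \in G_e,\; rs=g} \sigma_r(a_s)\, \alpha(r,s) = \sum_{t \in G_f,\; tr=g} a_t\, \alpha(t,r)$$ for all $e,f \in ob(G)$, $e \neq f$, and all $r,g \in G_{f,e}$.
   Context: Rings are associative and unital; ring homomorphisms preserve multiplicative identities. $G$ is a small category; an object is identified with its identity morphism; $s \in G$ means that $s$ is a morphism of $G$; $d(s)$ and $c(s)$ are the domain and codomain of $s$; $G^{(2)}$ is the set of pairs $(s,t)$ of morphisms with $d(s)=c(t)$ (so that $st$ is defined), and $G^{(3)}$ is the set of triples $(s,t,r)$ with $(s,t),(t,r)\in G^{(2)}$. A crossed system is a quadruple $\{A,G,\sigma,\alpha\}$ where $A$ is the direct sum of rings $A_e$, $e\in ob(G)$; $\sigma_s : A_{d(s)}\to A_{c(s)}$, $s\in G$, are ring homomorphisms; and $\alpha$ assigns to each $(s,t)\in G^{(2)}$ an element $\alpha(s,t)\in A_{c(s)}$, such that for all $e\in ob(G)$, all $(s,t,r)\in G^{(3)}$ and all $a\in A_{d(t)}$: $\sigma_e=\mathrm{id}_{A_e}$;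 $\alpha(s,d(s))=1_{A_{c(s)}}$; $\alpha(c(t),t)=1_{A_{c(t)}}$; $\alpha(s,t)\alpha(st,r)=\sigma_s(\alpha(t,r))\alpha(s,tr)$; $\sigma_s(\sigma_t(a))\alpha(s,t)=\alpha(s,t)\sigma_{st}(a)$. The category crossed product $A\rtimes_\alpha^\sigma G$ is the set of formal sums $\sum_{s\in G}a_su_s$ with $a_s\in A_{c(s)}$, all but finitely many zero, with componentwise addition and multiplication given by biadditive extension of $(a_su_s)(b_tu_t)=a_s\sigma_s(b_t)\alpha(s,t)u_{st}$ if $(s,t)\in G^{(2)}$ and $(a_su_s)(b_tu_t)=0$ otherwise. It is associative but need not have a multiplicative identity when $ob(G)$ is infinite. For $e,f\in ob(G)$, $G_{f,e}$ is the set of $s\in G$ with $c(s)=f$ and $d(s)=e$; $G_e:=G_{e,e}$ is a monoid; $\alpha_e$ and $\sigma_e$ in $A_e \rtimes_{\alpha_e}^{\sigma_e} G_e$ denote the restrictions of $\alpha$ to $G_e\times G_e$ and of $\sigma$ to $G_e$. Thus $A_e \rtimes_{\alpha_e}^{\sigma_e} G_e$ is the crossed product of the crossed system $\{A_e,G_e,\sigma_e,\alpha_e\}$ with $G_e$ viewed as a one-object category; it is viewed as a subset of $A\rtimes_\alpha^\sigma G$. $Z(\cdot)$ denotes the center. *)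

theory Defs
  imports "HOL-Algebra.Ring"
begin

text \<open>An object is identified with its identity morphism, so \<open>Dom\<close> and \<open>Cod\<close> map morphisms to
  morphisms. Composition is a total function, but only its values on \<open>composable\<close> pairs matter.\<close>

record 's small_cat =
  Mor :: "'s set"
  Dom :: "'s \<Rightarrow> 's"
  Cod :: "'s \<Rightarrow> 's"
  Comp :: "'s \<Rightarrow> 's \<Rightarrow> 's"  (infixl \<open>\<cdot>\<index>\<close> 70)

definition Ob :: "('s, 'm) small_cat_scheme \<Rightarrow> 's set"
  where "Ob G = Dom G ` Mor G"

definition composable :: "('s, 'm) small_cat_scheme \<Rightarrow> ('s \<times> 's) set"
  where "composable G = {(s, t). s \<in> Mor G \<and> t \<in> Mor G \<and> Dom G s = Cod G t}"

text \<open>The codomain comes first: \<open>hom_set G f e\<close> consists of the morphisms from \<open>e\<close> to \<open>f\<close>.\<close>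

definition hom_set :: "('s, 'm) small_cat_scheme \<Rightarrow> 's \<Rightarrow> 's \<Rightarrow> 's set"
  where "hom_set G f e = {s \<in> Mor G. Cod G s = f \<and> Dom G s = e}"

definition endo :: "('s, 'm) small_cat_scheme \<Rightarrow> 's \<Rightarrow> ('s, 'm) small_cat_scheme"
  where "endo G e = G\<lparr>Mor := hom_set G e e\<rparr>"

locale small_category =
  fixes G :: "('s, 'm) small_cat_scheme" (structure)
  assumes Dom_closed: "s \<in> Mor G \<Longrightarrow> Dom G s \<in> Mor G"
    and Cod_closed: "s \<in> Mor G \<Longrightarrow> Cod G s \<in> Mor G"
    and Dom_Dom: "s \<in> Mor G \<Longrightarrow> Dom G (Dom G s) = Dom G s"
    and Cod_Dom: "s \<in> Mor G \<Longrightarrow> Cod G (Dom G s) = Dom G s"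
    and Dom_Cod: "s \<in> Mor G \<Longrightarrow> Dom G (Cod G s) = Cod G s"
    and Cod_Cod: "s \<in> Mor G \<Longrightarrow> Cod G (Cod G s) = Cod G s"
    and Comp_closed: "(s, t) \<in> composable G \<Longrightarrow> s \<cdot> t \<in> Mor G"
    and Dom_Comp: "(s, t) \<in> composable G \<Longrightarrow> Dom G (s \<cdot> t) = Dom G t"
    and Cod_Comp: "(s, t) \<in> composable G \<Longrightarrow> Cod G (s \<cdot> t) = Cod G s"
    and Comp_assoc: "\<lbrakk>(s, t) \<in> composable G; (t, r) \<in> composable G\<rbrakk>
      \<Longrightarrow> (s \<cdot> t) \<cdot> r = s \<cdot> (t \<cdot> r)"
    and Comp_Dom: "s \<in> Mor G \<Longrightarrow> s \<cdot> Dom G s = s"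
    and Cod_Comp_left: "s \<in> Mor G \<Longrightarrow> Cod G s \<cdot> s = s"

text \<open>The direct sum of the rings \<open>A e\<close> is represented by the family of its components. The values
  of \<open>A\<close> at morphisms that are not objects are irrelevant.\<close>

locale crossed_system = small_category G
  for G :: "('s, 'm) small_cat_scheme" (structure)
    and A :: "'s \<Rightarrow> ('a, 'n) ring_scheme"
    and \<sigma> :: "'s \<Rightarrow> 'a \<Rightarrow> 'a"
    and \<alpha> :: "'s \<Rightarrow> 's \<Rightarrow> 'a" +
  assumes ring_A: "e \<in> Ob G \<Longrightarrow> ring (A e)"
    and \<sigma>_hom: "s \<in> Mor G \<Longrightarrow> \<sigma> s \<in> ring_hom (A (Dom G s)) (A (Cod G s))"
    and \<alpha>_closed: "(s, t) \<in> composable G \<Longrightarrow> \<alpha> s t \<in> carrier (A (Cod G s))"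
    and \<sigma>_id: "\<lbrakk>e \<in> Ob G; a \<in> carrier (A e)\<rbrakk> \<Longrightarrow> \<sigma> e a = a"
    and \<alpha>_Dom: "s \<in> Mor G \<Longrightarrow> \<alpha> s (Dom G s) = \<one>\<^bsub>A (Cod G s)\<^esub>"
    and \<alpha>_Cod: "t \<in> Mor G \<Longrightarrow> \<alpha> (Cod G t) t = \<one>\<^bsub>A (Cod G t)\<^esub>"
    and \<alpha>_cocycle: "\<lbrakk>(s, t) \<in> composable G; (t, r) \<in> composable G\<rbrakk>
      \<Longrightarrow> \<alpha> s t \<otimes>\<^bsub>A (Cod G s)\<^esub> \<alpha> (s \<cdot> t) r
        = \<sigma> s (\<alpha> t r) \<otimes>\<^bsub>A (Cod G s)\<^esub> \<alpha> s (t \<cdot> r)"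
    and \<sigma>_\<alpha>: "\<lbrakk>(s, t) \<in> composable G; a \<in> carrier (A (Dom G t))\<rbrakk>
      \<Longrightarrow> \<sigma> s (\<sigma> t a) \<otimes>\<^bsub>A (Cod G s)\<^esub> \<alpha> s t
        = \<alpha> s t \<otimes>\<^bsub>A (Cod G s)\<^esub> \<sigma> (s \<cdot> t) a"

text \<open>Sum of a family with finitely many nonzero members. (\<open>finsum\<close> over an infinite index set is
  zero by convention, even if only finitely many members are nonzero.)\<close>

definition fsum :: "('a, 'n) ring_scheme \<Rightarrow> ('i \<Rightarrow> 'a) \<Rightarrow> 'i set \<Rightarrow> 'a"
  where "fsum R f I = finsum R f {i \<in> I. f i \<noteq> \<zero>\<^bsub>R\<^esub>}"

text \<open>The formal sum of the \<open>x s u\<^sub>s\<close> is represented by its coefficient function \<open>x\<close>, which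
  is zero (in \<open>A (Cod G s)\<close>) at all \<open>s\<close> outside \<open>Mor G\<close>. As \<open>endo G e\<close> differs from \<open>G\<close> only
  in \<open>Mor\<close>, the carrier for \<open>endo G e\<close> is literally a subset of the carrier for \<open>G\<close>.

  The \<open>one\<close> component is the formal sum of all \<open>u\<^sub>e\<close> with \<open>e\<close> an object. If infinitely many of the
  \<open>A e\<close> are nonzero, it is not in the carrier and there is no multiplicative identity.\<close>

definition crossed_product ::
  "('s, 'm) small_cat_scheme \<Rightarrow> ('s \<Rightarrow> ('a, 'n) ring_scheme) \<Rightarrow> ('s \<Rightarrow> 'a \<Rightarrow> 'a)
    \<Rightarrow> ('s \<Rightarrow> 's \<Rightarrow> 'a) \<Rightarrow> ('s \<Rightarrow> 'a) ring"
  where "crossed_product G A \<sigma> \<alpha> = \<lparr>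
    carrier = {x. (\<forall>s \<in> Mor G. x s \<in> carrier (A (Cod G s)))
      \<and> (\<forall>s. s \<notin> Mor G \<longrightarrow> x s = \<zero>\<^bsub>A (Cod G s)\<^esub>)
      \<and> finite {s \<in> Mor G. x s \<noteq> \<zero>\<^bsub>A (Cod G s)\<^esub>}},
    monoid.mult = (\<lambda>x y g. fsum (A (Cod G g))
      (\<lambda>(s, t). x s \<otimes>\<^bsub>A (Cod G g)\<^esub> \<sigma> s (y t) \<otimes>\<^bsub>A (Cod G g)\<^esub> \<alpha> s t)
      {(s, t) \<in> composable G. s \<cdot>\<^bsub>G\<^esub> t = g}),
    one = (\<lambda>s. if s \<in> Ob G then \<one>\<^bsub>A s\<^esub> else \<zero>\<^bsub>A (Cod G s)\<^esub>),
    zero = (\<lambda>s. \<zero>\<^bsub>A (Cod G s)\<^esub>),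
    add = (\<lambda>x y s. if s \<in> Mor G then x s \<oplus>\<^bsub>A (Cod G s)\<^esub> y s else \<zero>\<^bsub>A (Cod G s)\<^esub>)\<rparr>"

definition center :: "('a, 'n) ring_scheme \<Rightarrow> 'a set"
  where "center R = {x \<in> carrier R. \<forall>y \<in> carrier R. x \<otimes>\<^bsub>R\<^esub> y = y \<otimes>\<^bsub>R\<^esub> x}"

definition sum_of_sets :: "('a, 'n) ring_scheme \<Rightarrow> ('i \<Rightarrow> 'a set) \<Rightarrow> 'i set \<Rightarrow> 'a set"
  where "sum_of_sets R Z I =
    {fsum R z I | z. (\<forall>i \<in> I. z i \<in> Z i) \<and> finite {i \<in> I. z i \<noteq> \<zero>\<^bsub>R\<^esub>}}"

lemma Mor_endo: "Mor (endo G e) = hom_set G e e"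
  by (simp add: endo_def)

lemma endo_sel [simp]: "Dom (endo G e) = Dom G" "Cod (endo G e) = Cod G" "Comp (endo G e) = Comp G"
  by (simp_all add: endo_def)

lemma carrier_crossed_product_endo_subset:
  assumes "crossed_system G A \<sigma> \<alpha>"
  shows "carrier (crossed_product (endo G e) A \<sigma> \<alpha>) \<subseteq> carrier (crossed_product G A \<sigma> \<alpha>)"
proof
  interpret crossed_system G A \<sigma> \<alpha> by fact
  fix x assume x: "x \<in> carrier (crossed_product (endo G e) A \<sigma> \<alpha>)"
  have zero: "\<zero>\<^bsub>A (Cod G s)\<^esub> \<in> carrier (A (Cod G s))" if "s \<in> Mor G" for s
  proof -
    have "Cod G s \<in> Ob G"
      using that Cod_closed Dom_Cod unfolding Ob_def by (metis image_eqI)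
    then show ?thesis
      using ring_A ring.ring_simprules(2) by blast
  qed
  have "{s \<in> Mor G. x s \<noteq> \<zero>\<^bsub>A (Cod G s)\<^esub>} \<subseteq> {s \<in> hom_set G e e. x s \<noteq> \<zero>\<^bsub>A (Cod G s)\<^esub>}"
    using x by (auto simp: crossed_product_def Mor_endo)
  moreover have "finite {s \<in> hom_set G e e. x s \<noteq> \<zero>\<^bsub>A (Cod G s)\<^esub>}"
    using x by (simp add: crossed_product_def Mor_endo)
  ultimately have fin: "finite {s \<in> Mor G. x s \<noteq> \<zero>\<^bsub>A (Cod G s)\<^esub>}"
    by (rule finite_subset)
  have "x s \<in> carrier (A (Cod G s))" if "s \<in> Mor G" for s
    using x zero[OF that] by (cases "s \<in> hom_set G e e") (auto simp: crossed_product_def Mor_endo)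
  moreover have "x s = \<zero>\<^bsub>A (Cod G s)\<^esub>" if "s \<notin> Mor G" for s
    using x that by (auto simp: crossed_product_def Mor_endo hom_set_def)
  ultimately show "x \<in> carrier (crossed_product G A \<sigma> \<alpha>)"
    using fin by (simp add: crossed_product_def)
qed

lemma crossed_system_endo:
  assumes "crossed_system G A \<sigma> \<alpha>" "e \<in> Ob G"
  shows "crossed_system (endo G e) A \<sigma> \<alpha>"
proof -
  interpret crossed_system G A \<sigma> \<alpha> by fact
  have e: "e \<in> Mor G" "Dom G e = e" "Cod G e = e"
    using assms(2) Dom_closed Dom_Dom Cod_Dom by (auto simp: Ob_def)
  have M: "s \<in> Mor G" "Dom G s = e" "Cod G s = e" if "s \<in> Mor (endo G e)" for s
    using that by (auto simp: Mor_endo hom_set_def)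
  have MI: "s \<in> Mor (endo G e)" if "s \<in> Mor G" "Dom G s = e" "Cod G s = e" for s
    using that by (auto simp: Mor_endo hom_set_def)
  have C: "(s, t) \<in> composable G" if "(s, t) \<in> composable (endo G e)" for s t
    using that M by (auto simp: composable_def)
  have CM: "s \<in> Mor (endo G e)" "t \<in> Mor (endo G e)" if "(s, t) \<in> composable (endo G e)" for s t
    using that by (auto simp: composable_def)
  have O: "f = e" if "f \<in> Ob (endo G e)" for f
    using that M by (auto simp: Ob_def)
  show ?thesis
  proof (intro crossed_system.intro small_category.intro crossed_system_axioms.intro, unfold endo_sel)
    show "s \<cdot>\<^bsub>G\<^esub> t \<in> Mor (endo G e)" if "(s, t) \<in> composable (endo G e)" for s t
      using that by (intro MI) (simp_all add: C CM M Comp_closed Dom_Comp Cod_Comp)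
    show "Dom G s \<in> Mor (endo G e)" "Cod G s \<in> Mor (endo G e)" if "s \<in> Mor (endo G e)" for s
      using that by (simp_all add: M e MI)
    show "ring (A f)" if "f \<in> Ob (endo G e)" for f
      using that O ring_A assms(2) by blast
    show "\<sigma> f a = a" if "f \<in> Ob (endo G e)" "a \<in> carrier (A f)" for f a
      using that O \<sigma>_id assms(2) by blast
  qed (blast intro: M(1) C Dom_Dom Cod_Dom Dom_Cod Cod_Cod Dom_Comp Cod_Comp Comp_assoc Comp_Dom
      Cod_Comp_left \<sigma>_hom \<alpha>_closed \<alpha>_Dom \<alpha>_Cod \<alpha>_cocycle \<sigma>_\<alpha>)+
qed

end

theory Submission
  imports Defs
begin

text \<open>
  Write a formal sum as \<open>x\<close> and its coefficients as \<open>x s\<close>. As multiplication is biadditive, \<open>x\<close> is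
  central iff it commutes with every monomial \<open>b u\<^sub>r\<close>. Comparing coefficients at \<open>g\<close>, this means that
  the sum of \<open>x t \<sigma>\<^sub>t(b) \<alpha>(t,r)\<close> over all \<open>t\<close> with \<open>tr = g\<close> equals the sum of \<open>b \<sigma>\<^sub>r(x s) \<alpha>(r,s)\<close>
  over all \<open>s\<close> with \<open>rs = g\<close>.

  For \<open>r\<close> an object these equations are local: \<open>b = 1\<close> shows that \<open>x\<close> vanishes off the
  endomorphisms, and general \<open>b\<close> that \<open>x s \<sigma>\<^sub>s(b) = b x s\<close> for each endomorphism \<open>s\<close>. These two
  properties form \<open>commutes_with_base\<close>. For arbitrary \<open>r\<close> and \<open>b = 1\<close> the equations with \<open>g\<close> parallel
  to \<open>r\<close> are the condition of the theorem, here called \<open>intertwines\<close>, but for all pairs of objects,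
  equal ones included. Conversely, \<open>commutes_with_base\<close> makes both sides zero if \<open>g\<close> is not parallel
  to \<open>r\<close>, and otherwise allows \<open>b\<close> to be pulled out to the left, which leaves \<open>b\<close> times the equation
  for \<open>b = 1\<close>. So these two conditions characterize the center (\<open>center_iff\<close>).

  The characterization applies equally to the crossed system over \<open>endo G e\<close>. There it consists of the
  conditions on endomorphisms of \<open>e\<close> and of \<open>intertwines\<close> for the pair \<open>(e, e)\<close>
  (\<open>center_endo_iff\<close>). Thus the conditions over \<open>G\<close> split into vanishing off the endomorphisms, which
  says that \<open>x\<close> is a sum of elements of the local crossed products; centrality of the local parts;
  and \<open>intertwines\<close> for pairs of distinct objects.
\<close>

section \<open>Sums with finite support\<close>

lemma fsum_cong:
  assumes "abelian_monoid R" "I = J" "\<And>i. i \<in> J \<Longrightarrow> f i = g i" "\<And>i. i \<in> J \<Longrightarrow> g i \<in> carrier R"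
  shows "fsum R f I = fsum R g J"
  unfolding fsum_def by (rule abelian_monoid.finsum_cong'[OF assms(1)]) (use assms in auto)

text \<open>For an arbitrary record \<open>R\<close> the empty sum need not be zero: its value is given by a definite
  description that is unspecified if \<open>\<zero>\<close> is not in the carrier. It never depends on the summand,
  and this is what is needed at arguments \<open>g\<close> that are not morphisms.\<close>

lemma fsum_empty_cong:
  fixes f g :: "'i \<Rightarrow> 'a"
  shows "fsum R f {} = fsum R g {}"
proof -
  have "({}, v) \<in> foldSetD D h z \<longleftrightarrow> v = z \<and> z \<in> D" for D v z and h :: "'i \<Rightarrow> 'a \<Rightarrow> 'a"
    by (auto intro: foldSetD.emptyI elim: empty_foldSetDE)
  then show ?thesis
    by (simp add: fsum_def finsum_def finprod_def foldD_def)
qed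

lemma (in abelian_monoid) fsum_closed:
  assumes "\<And>i. i \<in> I \<Longrightarrow> f i \<in> carrier G"
  shows "fsum G f I \<in> carrier G"
  unfolding fsum_def by (rule finsum_closed) (use assms in auto)

lemma (in abelian_monoid) fsum_zero:
  assumes "\<And>i. i \<in> I \<Longrightarrow> f i = \<zero>"
  shows "fsum G f I = \<zero>"
proof -
  have "{i \<in> I. f i \<noteq> \<zero>} = {}"
    using assms by blast
  then show ?thesis
    by (simp only: fsum_def finsum_empty)
qed

lemma (in abelian_monoid) finsum_single: "f i \<in> carrier G \<Longrightarrow> finsum G f {i} = f i"
  by simp

lemma (in abelian_monoid) fsum_singleton:
  assumes "f i \<in> carrier G"
  shows "fsum G f {i} = f i"
proof (cases "f i = \<zero>")
  case True
  then have "fsum G f {i} = \<zero>"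
    by (intro fsum_zero) simp
  with True show ?thesis
    by simp
next
  case False
  then have "{j \<in> {i}. f j \<noteq> \<zero>} = {i}"
    by blast
  then show ?thesis
    using assms by (simp add: fsum_def finsum_insert)
qed

lemma (in abelian_monoid) fsum_reindex:
  assumes "inj_on h I" "\<And>i. i \<in> I \<Longrightarrow> f (h i) \<in> carrier G"
  shows "fsum G f (h ` I) = fsum G (\<lambda>i. f (h i)) I"
proof -
  have "{j \<in> h ` I. f j \<noteq> \<zero>} = h ` {i \<in> I. f (h i) \<noteq> \<zero>}"
    by blast
  moreover have "inj_on h {i \<in> I. f (h i) \<noteq> \<zero>}"
    using assms(1) by (rule inj_on_subset) blast
  ultimately show ?thesis
    unfolding fsum_def using assms(2) by (auto intro!: finsum_reindex)
qed

text \<open>The set \<open>T\<close> is any finite set of indices that captures the support. Enlarging \<open>T\<close> beyond the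
  values of \<open>h\<close> on the support only adds zero summands.\<close>

lemma (in abelian_monoid) fsum_fibres:
  assumes "finite {p \<in> K. f p \<noteq> \<zero>}" "\<And>p. p \<in> K \<Longrightarrow> f p \<in> carrier G"
    and "finite T" "\<And>p. \<lbrakk>p \<in> K; f p \<noteq> \<zero>\<rbrakk> \<Longrightarrow> h p \<in> T"
  shows "fsum G f K = finsum G (\<lambda>t. fsum G f {p \<in> K. h p = t}) T"
proof -
  let ?S = "\<lambda>t. {p \<in> {p \<in> K. h p = t}. f p \<noteq> \<zero>}"
  have "{p \<in> K. f p \<noteq> \<zero>} = (\<Union>t\<in>T. ?S t)"
    using assms(4) by blast
  moreover have "finsum G f (\<Union>t\<in>T. ?S t) = finsum G (\<lambda>t. finsum G f (?S t)) T"
  proof (rule add.finprod_UN_disjoint)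
    show "finite (?S t)" for t
      using assms(1) by (rule finite_subset[rotated]) blast
    show "pairwise (\<lambda>i j. disjnt (?S i) (?S j)) T"
      by (auto simp: pairwise_def disjnt_def)
  qed (use assms in auto)
  ultimately show ?thesis
    by (simp add: fsum_def)
qed

lemma (in ring) fsum_rdistr:
  assumes "finite {i \<in> I. f i \<noteq> \<zero>}" "\<And>i. i \<in> I \<Longrightarrow> f i \<in> carrier R" "a \<in> carrier R"
  shows "a \<otimes> fsum R f I = fsum R (\<lambda>i. a \<otimes> f i) I"
proof -
  have "a \<otimes> fsum R f I = finsum R (\<lambda>i. a \<otimes> f i) {i \<in> I. f i \<noteq> \<zero>}"
    unfolding fsum_def using assms by (intro finsum_rdistr) auto
  also have "\<dots> = fsum R (\<lambda>i. a \<otimes> f i) I"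
    unfolding fsum_def
    by (rule add.finprod_mono_neutral_cong_right) (use assms in auto)
  finally show ?thesis .
qed

section \<open>Coefficients in a category crossed product\<close>

definition monomial ::
  "('s, 'm) small_cat_scheme \<Rightarrow> ('s \<Rightarrow> ('a, 'n) ring_scheme) \<Rightarrow> 's \<Rightarrow> 'a \<Rightarrow> 's \<Rightarrow> 'a"
  where "monomial G A r b = (\<lambda>s. if s = r then b else \<zero>\<^bsub>A (Cod G s)\<^esub>)"

text \<open>What it means, coefficientwise, for \<open>x\<close> to commute with all \<open>b u\<^sub>e\<close>, where \<open>e\<close> is an object and
  \<open>b\<close> is in \<open>A e\<close>.\<close>

definition commutes_with_base ::
  "('s, 'm) small_cat_scheme \<Rightarrow> ('s \<Rightarrow> ('a, 'n) ring_scheme) \<Rightarrow> ('s \<Rightarrow> 'a \<Rightarrow> 'a)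
    \<Rightarrow> ('s \<Rightarrow> 'a) \<Rightarrow> bool"
  where "commutes_with_base G A \<sigma> x \<longleftrightarrow> (\<forall>s \<in> Mor G.
    if Dom G s = Cod G s
    then \<forall>b \<in> carrier (A (Cod G s)). x s \<otimes>\<^bsub>A (Cod G s)\<^esub> \<sigma> s b = b \<otimes>\<^bsub>A (Cod G s)\<^esub> x s
    else x s = \<zero>\<^bsub>A (Cod G s)\<^esub>)"

text \<open>The coefficients at morphisms \<open>g\<close> from \<open>e\<close> to \<open>f\<close> of the equation \<open>u\<^sub>r x = x u\<^sub>r\<close>, for \<open>x\<close> supported
  on endomorphisms. Here \<open>e = f\<close> is meaningful: it gives the same condition inside one local crossed
  product.\<close>

definition intertwines ::
  "('s, 'm) small_cat_scheme \<Rightarrow> ('s \<Rightarrow> ('a, 'n) ring_scheme) \<Rightarrow> ('s \<Rightarrow> 'a \<Rightarrow> 'a)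
    \<Rightarrow> ('s \<Rightarrow> 's \<Rightarrow> 'a) \<Rightarrow> ('s \<Rightarrow> 'a) \<Rightarrow> 's \<Rightarrow> 's \<Rightarrow> bool"
  where "intertwines G A \<sigma> \<alpha> x e f \<longleftrightarrow> (\<forall>r \<in> hom_set G f e. \<forall>g \<in> hom_set G f e.
    fsum (A f) (\<lambda>s. \<sigma> r (x s) \<otimes>\<^bsub>A f\<^esub> \<alpha> r s) {s \<in> hom_set G e e. r \<cdot>\<^bsub>G\<^esub> s = g} =
    fsum (A f) (\<lambda>t. x t \<otimes>\<^bsub>A f\<^esub> \<alpha> t r) {t \<in> hom_set G f f. t \<cdot>\<^bsub>G\<^esub> r = g})"

context crossed_system
begin

lemma Ob_iff: "e \<in> Ob G \<longleftrightarrow> e \<in> Mor G \<and> Dom G e = e \<and> Cod G e = e"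
  unfolding Ob_def using Dom_closed Dom_Dom Cod_Dom by (auto simp: image_iff) metis

lemma Dom_Ob: "s \<in> Mor G \<Longrightarrow> Dom G s \<in> Ob G"
  by (simp add: Ob_def)

lemma Cod_Ob: "s \<in> Mor G \<Longrightarrow> Cod G s \<in> Ob G"
  by (simp add: Ob_iff Cod_closed Dom_Cod Cod_Cod)

lemma ring_Cod: "s \<in> Mor G \<Longrightarrow> ring (A (Cod G s))"
  by (simp add: ring_A Cod_Ob)

lemma ring_Dom: "s \<in> Mor G \<Longrightarrow> ring (A (Dom G s))"
  by (simp add: ring_A Dom_Ob)

lemma \<sigma>_closed:
  "\<lbrakk>s \<in> Mor G; a \<in> carrier (A (Dom G s))\<rbrakk> \<Longrightarrow> \<sigma> s a \<in> carrier (A (Cod G s))"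
  using ring_hom_closed[OF \<sigma>_hom] .

lemma \<sigma>_one: "s \<in> Mor G \<Longrightarrow> \<sigma> s \<one>\<^bsub>A (Dom G s)\<^esub> = \<one>\<^bsub>A (Cod G s)\<^esub>"
  using ring_hom_one[OF \<sigma>_hom] .

lemma \<sigma>_zero: "s \<in> Mor G \<Longrightarrow> \<sigma> s \<zero>\<^bsub>A (Dom G s)\<^esub> = \<zero>\<^bsub>A (Cod G s)\<^esub>"
  using ring_hom_zero[OF \<sigma>_hom ring_Dom ring_Cod] .

lemma composableD:
  assumes "(s, t) \<in> composable G"
  shows "s \<in> Mor G" "t \<in> Mor G" "Dom G s = Cod G t"
  using assms by (auto simp: composable_def)

abbreviation CP where "CP \<equiv> crossed_product G A \<sigma> \<alpha>"

lemma carrier_CP: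
  "x \<in> carrier CP \<longleftrightarrow> (\<forall>s \<in> Mor G. x s \<in> carrier (A (Cod G s)))
    \<and> (\<forall>s. s \<notin> Mor G \<longrightarrow> x s = \<zero>\<^bsub>A (Cod G s)\<^esub>)
    \<and> finite {s \<in> Mor G. x s \<noteq> \<zero>\<^bsub>A (Cod G s)\<^esub>}"
  by (simp add: crossed_product_def)

lemma zero_CP: "\<zero>\<^bsub>CP\<^esub> = (\<lambda>s. \<zero>\<^bsub>A (Cod G s)\<^esub>)"
  by (simp add: crossed_product_def)

lemma add_CP:
  "x \<oplus>\<^bsub>CP\<^esub> y = (\<lambda>s. if s \<in> Mor G then x s \<oplus>\<^bsub>A (Cod G s)\<^esub> y s else \<zero>\<^bsub>A (Cod G s)\<^esub>)"
  by (simp add: crossed_product_def)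

lemma coeff_closed: "\<lbrakk>x \<in> carrier CP; s \<in> Mor G\<rbrakk> \<Longrightarrow> x s \<in> carrier (A (Cod G s))"
  by (simp add: carrier_CP)

lemma abelian_monoid_CP: "abelian_monoid CP"
proof (rule abelian_monoidI)
  fix x y assume xy: "x \<in> carrier CP" "y \<in> carrier CP"
  have "{s \<in> Mor G. x s \<oplus>\<^bsub>A (Cod G s)\<^esub> y s \<noteq> \<zero>\<^bsub>A (Cod G s)\<^esub>}
      \<subseteq> {s \<in> Mor G. x s \<noteq> \<zero>\<^bsub>A (Cod G s)\<^esub>} \<union> {s \<in> Mor G. y s \<noteq> \<zero>\<^bsub>A (Cod G s)\<^esub>}"
    using ring.ring_simprules(8)[OF ring_Cod] ring.ring_simprules(2)[OF ring_Cod] by auto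
  then have "finite {s \<in> Mor G. x s \<oplus>\<^bsub>A (Cod G s)\<^esub> y s \<noteq> \<zero>\<^bsub>A (Cod G s)\<^esub>}"
    using xy by (auto simp: carrier_CP intro: finite_subset)
  then have "finite {s \<in> Mor G. (x \<oplus>\<^bsub>CP\<^esub> y) s \<noteq> \<zero>\<^bsub>A (Cod G s)\<^esub>}"
    by (rule finite_subset[rotated]) (auto simp: add_CP)
  then show "x \<oplus>\<^bsub>CP\<^esub> y \<in> carrier CP"
    using xy by (auto simp: carrier_CP add_CP ring.ring_simprules(1)[OF ring_Cod])
  show "x \<oplus>\<^bsub>CP\<^esub> y = y \<oplus>\<^bsub>CP\<^esub> x"
  proof
    fix s
    show "(x \<oplus>\<^bsub>CP\<^esub> y) s = (y \<oplus>\<^bsub>CP\<^esub> x) s"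
    proof (cases "s \<in> Mor G")
      case True
      then interpret ring "A (Cod G s)" by (rule ring_Cod)
      show ?thesis
        using True xy by (simp add: add_CP coeff_closed a_comm)
    qed (simp add: add_CP)
  qed
  fix z assume z: "z \<in> carrier CP"
  show "(x \<oplus>\<^bsub>CP\<^esub> y) \<oplus>\<^bsub>CP\<^esub> z = x \<oplus>\<^bsub>CP\<^esub> (y \<oplus>\<^bsub>CP\<^esub> z)"
  proof
    fix s
    show "((x \<oplus>\<^bsub>CP\<^esub> y) \<oplus>\<^bsub>CP\<^esub> z) s = (x \<oplus>\<^bsub>CP\<^esub> (y \<oplus>\<^bsub>CP\<^esub> z)) s"
    proof (cases "s \<in> Mor G")
      case True
      then interpret ring "A (Cod G s)" by (rule ring_Cod)
      show ?thesis
        using True xy z by (simp add: add_CP coeff_closed a_assoc)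
    qed (simp add: add_CP)
  qed
next
  show "\<zero>\<^bsub>CP\<^esub> \<in> carrier CP"
    by (simp add: carrier_CP zero_CP ring.ring_simprules(2)[OF ring_Cod])
  fix x assume x: "x \<in> carrier CP"
  show "\<zero>\<^bsub>CP\<^esub> \<oplus>\<^bsub>CP\<^esub> x = x"
  proof
    fix s
    show "(\<zero>\<^bsub>CP\<^esub> \<oplus>\<^bsub>CP\<^esub> x) s = x s"
      using x ring.ring_simprules(8)[OF ring_Cod]
      by (cases "s \<in> Mor G") (simp_all add: add_CP zero_CP carrier_CP)
  qed
qed

lemma term_closed:
  assumes "(s, t) \<in> composable G" "s \<cdot> t = g" "a \<in> carrier (A (Cod G s))" "b \<in> carrier (A (Cod G t))"
  shows "a \<otimes>\<^bsub>A (Cod G g)\<^esub> \<sigma> s b \<otimes>\<^bsub>A (Cod G g)\<^esub> \<alpha> s t \<in> carrier (A (Cod G g))"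
proof -
  have g: "Cod G g = Cod G s"
    using assms Cod_Comp by auto
  interpret ring "A (Cod G s)"
    using composableD(1)[OF assms(1)] by (rule ring_Cod)
  show ?thesis
    using assms(1,3,4) composableD[OF assms(1)] by (simp add: g \<sigma>_closed \<alpha>_closed)
qed

lemma term_nonzero:
  assumes "(s, t) \<in> composable G" "s \<cdot> t = g" "a \<in> carrier (A (Cod G s))" "b \<in> carrier (A (Cod G t))"
    and "a \<otimes>\<^bsub>A (Cod G g)\<^esub> \<sigma> s b \<otimes>\<^bsub>A (Cod G g)\<^esub> \<alpha> s t \<noteq> \<zero>\<^bsub>A (Cod G g)\<^esub>"
  shows "a \<noteq> \<zero>\<^bsub>A (Cod G s)\<^esub>" "b \<noteq> \<zero>\<^bsub>A (Cod G t)\<^esub>"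
proof -
  have g: "Cod G g = Cod G s"
    using assms Cod_Comp by auto
  interpret ring "A (Cod G s)"
    using composableD(1)[OF assms(1)] by (rule ring_Cod)
  show "a \<noteq> \<zero>\<^bsub>A (Cod G s)\<^esub>"
    using assms composableD[OF assms(1)] by (auto simp: g \<sigma>_closed \<alpha>_closed)
  show "b \<noteq> \<zero>\<^bsub>A (Cod G t)\<^esub>"
    using assms composableD[OF assms(1)] \<sigma>_zero[of s] by (auto simp: g \<alpha>_closed)
qed

lemma mult_coeff:
  "(x \<otimes>\<^bsub>CP\<^esub> y) g = fsum (A (Cod G g))
      (\<lambda>(s, t). x s \<otimes>\<^bsub>A (Cod G g)\<^esub> \<sigma> s (y t) \<otimes>\<^bsub>A (Cod G g)\<^esub> \<alpha> s t)
      {(s, t) \<in> composable G. s \<cdot> t = g}"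
  by (simp add: crossed_product_def)

text \<open>Outside \<open>Mor G\<close> the record \<open>A (Cod G g)\<close> is arbitrary, so the value of a product there is not known
  to be zero. For equations between products it is enough that all products agree there.\<close>

lemma mult_coeff_nonmor:
  assumes "g \<notin> Mor G"
  shows "(x \<otimes>\<^bsub>CP\<^esub> y) g = (x' \<otimes>\<^bsub>CP\<^esub> y') g"
proof -
  have "{(s, t) \<in> composable G. s \<cdot> t = g} = {}"
    using assms Comp_closed by auto
  then show ?thesis
    by (simp only: mult_coeff fsum_empty_cong)
qed

lemma finite_support_term:
  assumes "x \<in> carrier CP" "y \<in> carrier CP"
  shows "finite {p \<in> {(s, t) \<in> composable G. s \<cdot> t = g}.
    (case p of (s, t) \<Rightarrow> x s \<otimes>\<^bsub>A (Cod G g)\<^esub> \<sigma> s (y t) \<otimes>\<^bsub>A (Cod G g)\<^esub> \<alpha> s t) \<noteq> \<zero>\<^bsub>A (Cod G g)\<^esub>}"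
    (is "finite ?N")
proof -
  have "?N \<subseteq> {s \<in> Mor G. x s \<noteq> \<zero>\<^bsub>A (Cod G s)\<^esub>} \<times> {t \<in> Mor G. y t \<noteq> \<zero>\<^bsub>A (Cod G t)\<^esub>}"
  proof
    fix p assume p: "p \<in> ?N"
    obtain s t where st: "p = (s, t)"
      by (cases p)
    show "p \<in> {s \<in> Mor G. x s \<noteq> \<zero>\<^bsub>A (Cod G s)\<^esub>} \<times> {t \<in> Mor G. y t \<noteq> \<zero>\<^bsub>A (Cod G t)\<^esub>}"
      using p assms composableD[of s t] term_nonzero[of s t g "x s" "y t"]
      by (simp add: st coeff_closed)
  qed
  then show ?thesis
    by (rule finite_subset) (use assms in \<open>simp add: carrier_CP\<close>)
qed

text \<open>Grouping the terms of a product by one factor expresses it through products with monomials: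
  the summand for \<open>t\<close> is the coefficient at \<open>g\<close> of \<open>x\<close> times \<open>(y t) u\<^sub>t\<close>.\<close>

lemma mult_coeff_by_right:
  assumes xy: "x \<in> carrier CP" "y \<in> carrier CP" and g: "g \<in> Mor G"
    and T: "finite T" "{t \<in> Mor G. y t \<noteq> \<zero>\<^bsub>A (Cod G t)\<^esub>} \<subseteq> T"
  shows "(x \<otimes>\<^bsub>CP\<^esub> y) g = finsum (A (Cod G g)) (\<lambda>t. fsum (A (Cod G g))
      (\<lambda>s. x s \<otimes>\<^bsub>A (Cod G g)\<^esub> \<sigma> s (y t) \<otimes>\<^bsub>A (Cod G g)\<^esub> \<alpha> s t)
      {s. (s, t) \<in> composable G \<and> s \<cdot> t = g}) T"
proof -
  interpret R: ring "A (Cod G g)" using g by (rule ring_Cod)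
  let ?f = "\<lambda>s t. x s \<otimes>\<^bsub>A (Cod G g)\<^esub> \<sigma> s (y t) \<otimes>\<^bsub>A (Cod G g)\<^esub> \<alpha> s t"
  let ?K = "{(s, t) \<in> composable G. s \<cdot> t = g}"
  let ?I = "\<lambda>t. {s. (s, t) \<in> composable G \<and> s \<cdot> t = g}"
  have cl: "?f s t \<in> carrier (A (Cod G g))" if "(s, t) \<in> ?K" for s t
    using that xy composableD[of s t] term_closed[of s t g "x s" "y t"] by (simp add: coeff_closed)
  have "(x \<otimes>\<^bsub>CP\<^esub> y) g = finsum (A (Cod G g)) (\<lambda>t. fsum (A (Cod G g)) (\<lambda>(s, t). ?f s t)
      {p \<in> ?K. snd p = t}) T"
    unfolding mult_coeff
  proof (rule R.fsum_fibres[OF finite_support_term[OF xy] _ T(1)])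
    fix p assume p: "p \<in> ?K"
    then show "(case p of (s, t) \<Rightarrow> ?f s t) \<in> carrier (A (Cod G g))"
      using cl by auto
    assume "(case p of (s, t) \<Rightarrow> ?f s t) \<noteq> \<zero>\<^bsub>A (Cod G g)\<^esub>"
    moreover obtain s t where "p = (s, t)"
      by (cases p)
    ultimately have "snd p \<in> Mor G \<and> y (snd p) \<noteq> \<zero>\<^bsub>A (Cod G (snd p))\<^esub>"
      using p xy composableD[of s t] term_nonzero[of s t g "x s" "y t"] by (simp add: coeff_closed)
    then show "snd p \<in> T"
      using T(2) by blast
  qed
  also have "\<dots> = finsum (A (Cod G g)) (\<lambda>t. fsum (A (Cod G g)) (\<lambda>s. ?f s t) (?I t)) T"
  proof (rule R.finsum_cong'[OF refl])
    fix t
    have eq: "{p \<in> ?K. snd p = t} = (\<lambda>s. (s, t)) ` ?I t"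
      by auto
    show "fsum (A (Cod G g)) (\<lambda>(s, t). ?f s t) {p \<in> ?K. snd p = t}
        = fsum (A (Cod G g)) (\<lambda>s. ?f s t) (?I t)"
      unfolding eq using cl by (subst R.fsum_reindex) (auto simp: inj_on_def)
  qed (use cl in \<open>auto intro!: R.fsum_closed\<close>)
  finally show ?thesis .
qed

lemma mult_coeff_by_left:
  assumes xy: "x \<in> carrier CP" "y \<in> carrier CP" and g: "g \<in> Mor G"
    and T: "finite T" "{s \<in> Mor G. x s \<noteq> \<zero>\<^bsub>A (Cod G s)\<^esub>} \<subseteq> T"
  shows "(x \<otimes>\<^bsub>CP\<^esub> y) g = finsum (A (Cod G g)) (\<lambda>s. fsum (A (Cod G g))
      (\<lambda>t. x s \<otimes>\<^bsub>A (Cod G g)\<^esub> \<sigma> s (y t) \<otimes>\<^bsub>A (Cod G g)\<^esub> \<alpha> s t)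
      {t. (s, t) \<in> composable G \<and> s \<cdot> t = g}) T"
proof -
  interpret R: ring "A (Cod G g)" using g by (rule ring_Cod)
  let ?f = "\<lambda>s t. x s \<otimes>\<^bsub>A (Cod G g)\<^esub> \<sigma> s (y t) \<otimes>\<^bsub>A (Cod G g)\<^esub> \<alpha> s t"
  let ?K = "{(s, t) \<in> composable G. s \<cdot> t = g}"
  let ?I = "\<lambda>s. {t. (s, t) \<in> composable G \<and> s \<cdot> t = g}"
  have cl: "?f s t \<in> carrier (A (Cod G g))" if "(s, t) \<in> ?K" for s t
    using that xy composableD[of s t] term_closed[of s t g "x s" "y t"] by (simp add: coeff_closed)
  have "(x \<otimes>\<^bsub>CP\<^esub> y) g = finsum (A (Cod G g)) (\<lambda>s. fsum (A (Cod G g)) (\<lambda>(s, t). ?f s t)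
      {p \<in> ?K. fst p = s}) T"
    unfolding mult_coeff
  proof (rule R.fsum_fibres[OF finite_support_term[OF xy] _ T(1)])
    fix p assume p: "p \<in> ?K"
    then show "(case p of (s, t) \<Rightarrow> ?f s t) \<in> carrier (A (Cod G g))"
      using cl by auto
    assume "(case p of (s, t) \<Rightarrow> ?f s t) \<noteq> \<zero>\<^bsub>A (Cod G g)\<^esub>"
    moreover obtain s t where "p = (s, t)"
      by (cases p)
    ultimately have "fst p \<in> Mor G \<and> x (fst p) \<noteq> \<zero>\<^bsub>A (Cod G (fst p))\<^esub>"
      using p xy composableD[of s t] term_nonzero[of s t g "x s" "y t"] by (simp add: coeff_closed)
    then show "fst p \<in> T"
      using T(2) by blast
  qed
  also have "\<dots> = finsum (A (Cod G g)) (\<lambda>s. fsum (A (Cod G g)) (\<lambda>t. ?f s t) (?I s)) T"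
  proof (rule R.finsum_cong'[OF refl])
    fix s
    have eq: "{p \<in> ?K. fst p = s} = Pair s ` ?I s"
      by auto
    show "fsum (A (Cod G g)) (\<lambda>(s, t). ?f s t) {p \<in> ?K. fst p = s}
        = fsum (A (Cod G g)) (\<lambda>t. ?f s t) (?I s)"
      unfolding eq using cl by (subst R.fsum_reindex) (auto simp: inj_on_def)
  qed (use cl in \<open>auto intro!: R.fsum_closed\<close>)
  finally show ?thesis .
qed

section \<open>Coefficients of central elements\<close>

lemma monomial_at: "monomial G A r b r = b"
  by (simp add: monomial_def)

lemma monomial_support: "{s \<in> Mor G. monomial G A r b s \<noteq> \<zero>\<^bsub>A (Cod G s)\<^esub>} \<subseteq> {r}"
  by (auto simp: monomial_def)

lemma monomial_closed:
  assumes "r \<in> Mor G" "b \<in> carrier (A (Cod G r))"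
  shows "monomial G A r b \<in> carrier CP"
proof -
  have "finite {s \<in> Mor G. monomial G A r b s \<noteq> \<zero>\<^bsub>A (Cod G s)\<^esub>}"
    by (rule finite_subset[OF monomial_support]) simp
  then show ?thesis
    using assms ring.ring_simprules(2)[OF ring_Cod] by (auto simp: carrier_CP monomial_def)
qed

lemma mult_monomial_coeff:
  assumes x: "x \<in> carrier CP" and r: "r \<in> Mor G" "b \<in> carrier (A (Cod G r))" and g: "g \<in> Mor G"
  shows "(x \<otimes>\<^bsub>CP\<^esub> monomial G A r b) g = fsum (A (Cod G g))
    (\<lambda>s. x s \<otimes>\<^bsub>A (Cod G g)\<^esub> \<sigma> s b \<otimes>\<^bsub>A (Cod G g)\<^esub> \<alpha> s r) {s. (s, r) \<in> composable G \<and> s \<cdot> r = g}"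
proof -
  interpret R: ring "A (Cod G g)" using g by (rule ring_Cod)
  have "fsum (A (Cod G g)) (\<lambda>s. x s \<otimes>\<^bsub>A (Cod G g)\<^esub> \<sigma> s b \<otimes>\<^bsub>A (Cod G g)\<^esub> \<alpha> s r)
      {s. (s, r) \<in> composable G \<and> s \<cdot> r = g} \<in> carrier (A (Cod G g))"
  proof (rule R.fsum_closed)
    fix s assume "s \<in> {s. (s, r) \<in> composable G \<and> s \<cdot> r = g}"
    then show "x s \<otimes>\<^bsub>A (Cod G g)\<^esub> \<sigma> s b \<otimes>\<^bsub>A (Cod G g)\<^esub> \<alpha> s r \<in> carrier (A (Cod G g))"
      using x r composableD[of s r] term_closed[of s r g "x s" "b"] by (simp add: coeff_closed)
  qed
  then show ?thesis
    using mult_coeff_by_right[OF x monomial_closed[OF r] g _ monomial_support]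
    by (simp only: R.finsum_single monomial_at finite.intros)
qed

lemma monomial_mult_coeff:
  assumes x: "x \<in> carrier CP" and r: "r \<in> Mor G" "b \<in> carrier (A (Cod G r))" and g: "g \<in> Mor G"
  shows "(monomial G A r b \<otimes>\<^bsub>CP\<^esub> x) g = fsum (A (Cod G g))
    (\<lambda>s. b \<otimes>\<^bsub>A (Cod G g)\<^esub> \<sigma> r (x s) \<otimes>\<^bsub>A (Cod G g)\<^esub> \<alpha> r s) {s. (r, s) \<in> composable G \<and> r \<cdot> s = g}"
proof -
  interpret R: ring "A (Cod G g)" using g by (rule ring_Cod)
  have "fsum (A (Cod G g)) (\<lambda>s. b \<otimes>\<^bsub>A (Cod G g)\<^esub> \<sigma> r (x s) \<otimes>\<^bsub>A (Cod G g)\<^esub> \<alpha> r s)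
      {s. (r, s) \<in> composable G \<and> r \<cdot> s = g} \<in> carrier (A (Cod G g))"
  proof (rule R.fsum_closed)
    fix s assume "s \<in> {s. (r, s) \<in> composable G \<and> r \<cdot> s = g}"
    then show "b \<otimes>\<^bsub>A (Cod G g)\<^esub> \<sigma> r (x s) \<otimes>\<^bsub>A (Cod G g)\<^esub> \<alpha> r s \<in> carrier (A (Cod G g))"
      using x r composableD[of r s] term_closed[of r s g "b" "x s"] by (simp add: coeff_closed)
  qed
  then show ?thesis
    using mult_coeff_by_left[OF monomial_closed[OF r] x g _ monomial_support]
    by (simp only: R.finsum_single monomial_at finite.intros)
qed

text \<open>A solution of \<open>sr = g\<close> with \<open>r\<close> and \<open>g\<close> parallel is automatically an endomorphism of the common
  codomain, and a solution of \<open>rs = g\<close> one of the common domain.\<close>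

lemma composable_parallel_right:
  assumes "r \<in> hom_set G f e" "g \<in> hom_set G f e"
  shows "{s. (s, r) \<in> composable G \<and> s \<cdot> r = g} = {s \<in> hom_set G f f. s \<cdot> r = g}"
  using assms by (auto simp: hom_set_def composable_def Cod_Comp[unfolded composable_def])

lemma composable_parallel_left:
  assumes "r \<in> hom_set G f e" "g \<in> hom_set G f e"
  shows "{s. (r, s) \<in> composable G \<and> r \<cdot> s = g} = {s \<in> hom_set G e e. r \<cdot> s = g}"
  using assms by (auto simp: hom_set_def composable_def Dom_Comp[unfolded composable_def])

text \<open>The heart of the sufficiency proof: the coefficient at \<open>g\<close> of the equation
  \<open>x (b u\<^sub>r) = (b u\<^sub>r) x\<close>. If \<open>g\<close> is not parallel to \<open>r\<close>, every solution of \<open>sr = g\<close> or \<open>rs = g\<close> is a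
  non-endomorphism, where \<open>x\<close> vanishes. If it is parallel, \<open>x s \<sigma>\<^sub>s(b) = b x s\<close> moves \<open>b\<close> to the front
  and reduces the claim to \<open>b = 1\<close>.\<close>

lemma monomial_terms_commute:
  assumes x: "x \<in> carrier CP" and base: "commutes_with_base G A \<sigma> x"
    and inter: "intertwines G A \<sigma> \<alpha> x (Dom G r) (Cod G r)"
    and r: "r \<in> Mor G" "b \<in> carrier (A (Cod G r))" and g: "g \<in> Mor G"
  shows "fsum (A (Cod G g)) (\<lambda>s. x s \<otimes>\<^bsub>A (Cod G g)\<^esub> \<sigma> s b \<otimes>\<^bsub>A (Cod G g)\<^esub> \<alpha> s r)
      {s. (s, r) \<in> composable G \<and> s \<cdot> r = g}
    = fsum (A (Cod G g)) (\<lambda>s. b \<otimes>\<^bsub>A (Cod G g)\<^esub> \<sigma> r (x s) \<otimes>\<^bsub>A (Cod G g)\<^esub> \<alpha> r s)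
      {s. (r, s) \<in> composable G \<and> r \<cdot> s = g}"
    (is "fsum _ ?l ?L = fsum _ ?r ?R")
proof -
  interpret R: ring "A (Cod G g)" using g by (rule ring_Cod)
  have supp: "Dom G s = Cod G s" if "s \<in> Mor G" "x s \<noteq> \<zero>\<^bsub>A (Cod G s)\<^esub>" for s
    using that base by (auto simp: commutes_with_base_def split: if_splits)
  show ?thesis
  proof (cases "Dom G g = Dom G r \<and> Cod G g = Cod G r")
    case False
    have "?l s = \<zero>\<^bsub>A (Cod G g)\<^esub>" if "s \<in> ?L" for s
    proof (rule ccontr)
      assume "?l s \<noteq> \<zero>\<^bsub>A (Cod G g)\<^esub>"
      then have "x s \<noteq> \<zero>\<^bsub>A (Cod G s)\<^esub>"
        using that x r term_nonzero(1)[of s r g "x s" b] composableD[of s r]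
        by (simp add: coeff_closed)
      then show False
        using False that supp[of s] Dom_Comp[of s r] Cod_Comp[of s r] composableD[of s r] by auto
    qed
    moreover have "?r s = \<zero>\<^bsub>A (Cod G g)\<^esub>" if "s \<in> ?R" for s
    proof (rule ccontr)
      assume "?r s \<noteq> \<zero>\<^bsub>A (Cod G g)\<^esub>"
      then have "x s \<noteq> \<zero>\<^bsub>A (Cod G s)\<^esub>"
        using that x r term_nonzero(2)[of r s g b "x s"] composableD[of r s]
        by (simp add: coeff_closed)
      then show False
        using False that supp[of s] Dom_Comp[of r s] Cod_Comp[of r s] composableD[of r s] by auto
    qed
    ultimately have "fsum (A (Cod G g)) ?l ?L = \<zero>\<^bsub>A (Cod G g)\<^esub>"
      and "fsum (A (Cod G g)) ?r ?R = \<zero>\<^bsub>A (Cod G g)\<^esub>"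
      by (auto intro!: R.fsum_zero)
    then show ?thesis
      by simp
  next
    case True
    define e f where "e = Dom G r" and "f = Cod G r"
    have rg: "r \<in> hom_set G f e" "g \<in> hom_set G f e"
      using True r g by (auto simp: e_def f_def hom_set_def)
    note L = composable_parallel_right[OF rg] and R = composable_parallel_left[OF rg]
    have f: "Cod G g = f" "Cod G r = f" and b: "b \<in> carrier (A f)"
      using True r by (simp_all add: f_def)
    interpret R: ring "A f" using R.ring_axioms by (simp add: f)
    have Lx: "x s \<in> carrier (A f)" "\<alpha> s r \<in> carrier (A f)" "x s \<otimes>\<^bsub>A f\<^esub> \<sigma> s b = b \<otimes>\<^bsub>A f\<^esub> x s"
      if "s \<in> ?L" for s
    proof -
      have "s \<in> hom_set G f f" "(s, r) \<in> composable G"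
        using that L by blast+
      then have s: "s \<in> Mor G" "Dom G s = f" "Cod G s = f" "(s, r) \<in> composable G"
        by (auto simp: hom_set_def)
      show "x s \<in> carrier (A f)" "\<alpha> s r \<in> carrier (A f)" "x s \<otimes>\<^bsub>A f\<^esub> \<sigma> s b = b \<otimes>\<^bsub>A f\<^esub> x s"
        using s b coeff_closed[OF x, of s] \<alpha>_closed[of s r] base
        by (auto simp: commutes_with_base_def)
    qed
    have Rx: "\<sigma> r (x s) \<in> carrier (A f)" "\<alpha> r s \<in> carrier (A f)" if "s \<in> ?R" for s
      using that composableD[of r s] coeff_closed[OF x, of s] \<sigma>_closed[of r "x s"] \<alpha>_closed[of r s]
      by (simp_all add: f)
    have finx: "finite {s \<in> Mor G. x s \<noteq> \<zero>\<^bsub>A (Cod G s)\<^esub>}"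
      using x by (simp add: carrier_CP)
    have finL: "finite {s \<in> ?L. x s \<otimes>\<^bsub>A f\<^esub> \<alpha> s r \<noteq> \<zero>\<^bsub>A f\<^esub>}"
    proof (rule finite_subset[OF _ finx], rule)
      fix s assume s: "s \<in> {s \<in> ?L. x s \<otimes>\<^bsub>A f\<^esub> \<alpha> s r \<noteq> \<zero>\<^bsub>A f\<^esub>}"
      then have "s \<in> hom_set G f f" and a: "\<alpha> s r \<in> carrier (A f)"
        using L Lx(2)[of s] by blast+
      then have c: "s \<in> Mor G" "Cod G s = f"
        by (simp_all add: hom_set_def)
      have "x s \<noteq> \<zero>\<^bsub>A f\<^esub>"
        using s a by auto
      then show "s \<in> {s \<in> Mor G. x s \<noteq> \<zero>\<^bsub>A (Cod G s)\<^esub>}"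
        using c by simp
    qed
    have finR: "finite {s \<in> ?R. \<sigma> r (x s) \<otimes>\<^bsub>A f\<^esub> \<alpha> r s \<noteq> \<zero>\<^bsub>A f\<^esub>}"
    proof (rule finite_subset[OF _ finx], rule)
      fix s assume s: "s \<in> {s \<in> ?R. \<sigma> r (x s) \<otimes>\<^bsub>A f\<^esub> \<alpha> r s \<noteq> \<zero>\<^bsub>A f\<^esub>}"
      then have c: "s \<in> Mor G" "Dom G r = Cod G s" "\<alpha> r s \<in> carrier (A f)"
        using composableD[of r s] Rx[of s] by auto
      then have "x s \<noteq> \<zero>\<^bsub>A (Cod G s)\<^esub>"
        using s \<sigma>_zero[OF r(1)] by (auto simp: f)
      then show "s \<in> {s \<in> Mor G. x s \<noteq> \<zero>\<^bsub>A (Cod G s)\<^esub>}"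
        using c by blast
    qed
    have "fsum (A f) (\<lambda>s. x s \<otimes>\<^bsub>A f\<^esub> \<sigma> s b \<otimes>\<^bsub>A f\<^esub> \<alpha> s r) ?L
        = fsum (A f) (\<lambda>s. b \<otimes>\<^bsub>A f\<^esub> (x s \<otimes>\<^bsub>A f\<^esub> \<alpha> s r)) ?L"
      by (rule fsum_cong[OF R.abelian_monoid_axioms refl]) (use Lx b R.m_assoc in auto)
    also have "\<dots> = b \<otimes>\<^bsub>A f\<^esub> fsum (A f) (\<lambda>s. x s \<otimes>\<^bsub>A f\<^esub> \<alpha> s r) ?L"
      by (rule R.fsum_rdistr[OF finL, symmetric]) (use Lx b in auto)
    also have "fsum (A f) (\<lambda>s. x s \<otimes>\<^bsub>A f\<^esub> \<alpha> s r) ?L = fsum (A f) (\<lambda>s. \<sigma> r (x s) \<otimes>\<^bsub>A f\<^esub> \<alpha> r s) ?R"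
      using inter rg unfolding L R intertwines_def e_def f_def by simp
    also have "b \<otimes>\<^bsub>A f\<^esub> \<dots> = fsum (A f) (\<lambda>s. b \<otimes>\<^bsub>A f\<^esub> (\<sigma> r (x s) \<otimes>\<^bsub>A f\<^esub> \<alpha> r s)) ?R"
      by (rule R.fsum_rdistr[OF finR]) (use Rx b in auto)
    also have "\<dots> = fsum (A f) (\<lambda>s. b \<otimes>\<^bsub>A f\<^esub> \<sigma> r (x s) \<otimes>\<^bsub>A f\<^esub> \<alpha> r s) ?R"
      by (rule fsum_cong[OF R.abelian_monoid_axioms refl]) (use Rx b R.m_assoc in auto)
    finally show ?thesis
      by (simp add: f)
  qed
qed

text \<open>Both products are grouped by the monomials of \<open>y\<close>, and the groups agree one by one.\<close>

lemma mem_center: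
  assumes x: "x \<in> carrier CP" and base: "commutes_with_base G A \<sigma> x"
    and inter: "\<And>e f. \<lbrakk>e \<in> Ob G; f \<in> Ob G\<rbrakk> \<Longrightarrow> intertwines G A \<sigma> \<alpha> x e f"
  shows "x \<in> center CP"
proof -
  have "(x \<otimes>\<^bsub>CP\<^esub> y) g = (y \<otimes>\<^bsub>CP\<^esub> x) g" if y: "y \<in> carrier CP" for y g
  proof (cases "g \<in> Mor G")
    case False
    then show ?thesis
      by (rule mult_coeff_nonmor)
  next
    case g: True
    interpret R: ring "A (Cod G g)" using g by (rule ring_Cod)
    let ?T = "{t \<in> Mor G. y t \<noteq> \<zero>\<^bsub>A (Cod G t)\<^esub>}"
    have T: "finite ?T"
      using y by (simp add: carrier_CP)
    show ?thesis
      unfolding mult_coeff_by_right[OF x y g T subset_refl] mult_coeff_by_left[OF y x g T subset_refl]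
    proof (rule R.finsum_cong'[OF refl])
      fix r assume "r \<in> ?T"
      then have r: "r \<in> Mor G"
        by simp
      show "fsum (A (Cod G g)) (\<lambda>s. x s \<otimes>\<^bsub>A (Cod G g)\<^esub> \<sigma> s (y r) \<otimes>\<^bsub>A (Cod G g)\<^esub> \<alpha> s r)
          {s. (s, r) \<in> composable G \<and> s \<cdot> r = g}
        = fsum (A (Cod G g)) (\<lambda>s. y r \<otimes>\<^bsub>A (Cod G g)\<^esub> \<sigma> r (x s) \<otimes>\<^bsub>A (Cod G g)\<^esub> \<alpha> r s)
          {s. (r, s) \<in> composable G \<and> r \<cdot> s = g}"
        by (rule monomial_terms_commute[OF x base inter r coeff_closed[OF y r] g])
          (simp_all add: r Dom_Ob Cod_Ob)
    next
      show "(\<lambda>r. fsum (A (Cod G g))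
          (\<lambda>s. y r \<otimes>\<^bsub>A (Cod G g)\<^esub> \<sigma> r (x s) \<otimes>\<^bsub>A (Cod G g)\<^esub> \<alpha> r s)
          {s. (r, s) \<in> composable G \<and> r \<cdot> s = g}) \<in> ?T \<rightarrow> carrier (A (Cod G g))"
      proof (intro funcsetI R.fsum_closed)
        fix r s assume "s \<in> {s. (r, s) \<in> composable G \<and> r \<cdot> s = g}"
        then show "y r \<otimes>\<^bsub>A (Cod G g)\<^esub> \<sigma> r (x s) \<otimes>\<^bsub>A (Cod G g)\<^esub> \<alpha> r s \<in> carrier (A (Cod G g))"
          using x y composableD[of r s] term_closed[of r s g "y r" "x s"] by (simp add: coeff_closed)
      qed
    qed
  qed
  then show ?thesis
    using x by (auto simp: center_def)
qed

lemma center_monomial: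
  assumes x: "x \<in> center CP" and r: "r \<in> Mor G" "b \<in> carrier (A (Cod G r))" and g: "g \<in> Mor G"
  shows "fsum (A (Cod G g)) (\<lambda>s. x s \<otimes>\<^bsub>A (Cod G g)\<^esub> \<sigma> s b \<otimes>\<^bsub>A (Cod G g)\<^esub> \<alpha> s r)
      {s. (s, r) \<in> composable G \<and> s \<cdot> r = g}
    = fsum (A (Cod G g)) (\<lambda>s. b \<otimes>\<^bsub>A (Cod G g)\<^esub> \<sigma> r (x s) \<otimes>\<^bsub>A (Cod G g)\<^esub> \<alpha> r s)
      {s. (r, s) \<in> composable G \<and> r \<cdot> s = g}"
proof -
  have xC: "x \<in> carrier CP"
    using x by (simp add: center_def)
  have "x \<otimes>\<^bsub>CP\<^esub> monomial G A r b = monomial G A r b \<otimes>\<^bsub>CP\<^esub> x"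
    using x monomial_closed[OF r] by (simp add: center_def)
  then show ?thesis
    by (simp only: mult_monomial_coeff[OF xC r g, symmetric] monomial_mult_coeff[OF xC r g, symmetric])
qed

text \<open>Test against \<open>b u\<^sub>e\<close> for \<open>e\<close> the domain of \<open>s\<close>, at the coefficient \<open>s\<close>. Since \<open>e\<close> is an identity,
  \<open>te = s\<close> is solved by \<open>t = s\<close> alone, while \<open>et = s\<close> has the solution \<open>t = s\<close> if \<open>s\<close> is an endomorphism
  and none otherwise. In the latter case \<open>b = 1\<close> gives \<open>x s = 0\<close>.\<close>

lemma center_commutes_with_base:
  assumes x: "x \<in> center CP"
  shows "commutes_with_base G A \<sigma> x"
  unfolding commutes_with_base_def
proof
  fix s assume s: "s \<in> Mor G"
  interpret R: ring "A (Cod G s)" using s by (rule ring_Cod)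
  interpret D: ring "A (Dom G s)" using s by (rule ring_Dom)
  define e where "e = Dom G s"
  have e: "e \<in> Ob G" "e \<in> Mor G" "Dom G e = e" "Cod G e = e"
    using Dom_Ob[OF s] by (auto simp: e_def Ob_iff)
  have xs: "x s \<in> carrier (A (Cod G s))"
    using x s by (simp add: center_def coeff_closed)
  have unit: "t \<cdot> e = t" if "t \<in> Mor G" "Dom G t = e" for t
    using that Comp_Dom by blast
  have unit': "e \<cdot> t = t" if "t \<in> Mor G" "Cod G t = e" for t
    using that Cod_Comp_left by blast
  have L: "{t. (t, e) \<in> composable G \<and> t \<cdot> e = s} = {s}"
    using s e unit by (auto simp: composable_def e_def[symmetric])
  have R: "{t. (e, t) \<in> composable G \<and> e \<cdot> t = s} = (if Cod G s = e then {s} else {})"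
  proof -
    have "(e, t) \<in> composable G \<longleftrightarrow> t \<in> Mor G \<and> Cod G t = e" for t
      using e(2,3) by (auto simp: composable_def)
    then have "(e, t) \<in> composable G \<and> e \<cdot> t = s \<longleftrightarrow> t = s \<and> Cod G s = e" for t
      using s unit'[of t] by metis
    then show ?thesis
      by simp
  qed
  have eq: "x s \<otimes>\<^bsub>A (Cod G s)\<^esub> \<sigma> s b = fsum (A (Cod G s))
      (\<lambda>t. b \<otimes>\<^bsub>A (Cod G s)\<^esub> \<sigma> e (x t) \<otimes>\<^bsub>A (Cod G s)\<^esub> \<alpha> e t) (if Cod G s = e then {s} else {})"
    if b: "b \<in> carrier (A e)" for b
  proof -
    have "x s \<otimes>\<^bsub>A (Cod G s)\<^esub> \<sigma> s b \<in> carrier (A (Cod G s))"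
      using xs s b by (simp add: e_def \<sigma>_closed)
    then have "fsum (A (Cod G s)) (\<lambda>t. x t \<otimes>\<^bsub>A (Cod G s)\<^esub> \<sigma> t b \<otimes>\<^bsub>A (Cod G s)\<^esub> \<alpha> t e) {s}
        = x s \<otimes>\<^bsub>A (Cod G s)\<^esub> \<sigma> s b"
      using \<alpha>_Dom[OF s] by (subst R.fsum_singleton) (simp_all add: e_def)
    then show ?thesis
      using center_monomial[OF x e(2) _ s, of b] b unfolding L R by (simp add: e)
  qed
  show "if Dom G s = Cod G s
    then \<forall>b \<in> carrier (A (Cod G s)). x s \<otimes>\<^bsub>A (Cod G s)\<^esub> \<sigma> s b = b \<otimes>\<^bsub>A (Cod G s)\<^esub> x s
    else x s = \<zero>\<^bsub>A (Cod G s)\<^esub>"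
  proof (cases "Dom G s = Cod G s")
    case True
    have "x s \<otimes>\<^bsub>A (Cod G s)\<^esub> \<sigma> s b = b \<otimes>\<^bsub>A (Cod G s)\<^esub> x s" if b: "b \<in> carrier (A (Cod G s))" for b
    proof -
      have "\<sigma> e (x s) = x s" "\<alpha> e s = \<one>\<^bsub>A (Cod G s)\<^esub>"
        using \<sigma>_id[OF e(1)] \<alpha>_Cod[OF s] xs by (simp_all add: e_def True)
      then have "fsum (A (Cod G s)) (\<lambda>t. b \<otimes>\<^bsub>A (Cod G s)\<^esub> \<sigma> e (x t) \<otimes>\<^bsub>A (Cod G s)\<^esub> \<alpha> e t) {s}
          = b \<otimes>\<^bsub>A (Cod G s)\<^esub> x s"
        using xs b by (subst R.fsum_singleton) simp_all
      then show ?thesis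
        using eq[of b] b by (simp add: e_def True)
    qed
    then show ?thesis
      using True by simp
  next
    case False
    have empty: "fsum (A (Cod G s)) h {} = \<zero>\<^bsub>A (Cod G s)\<^esub>" for h :: "'s \<Rightarrow> 'a"
      by (rule R.fsum_zero) simp
    have "x s \<otimes>\<^bsub>A (Cod G s)\<^esub> \<sigma> s \<one>\<^bsub>A e\<^esub> = \<zero>\<^bsub>A (Cod G s)\<^esub>"
      using eq[of "\<one>\<^bsub>A e\<^esub>"] False empty by (simp add: e_def)
    then show ?thesis
      using False xs \<sigma>_one[OF s] by (simp add: e_def)
  qed
qed

text \<open>Test against \<open>u\<^sub>r\<close>, that is, \<open>b = 1\<close>.\<close>

lemma center_intertwines:
  assumes x: "x \<in> center CP"
  shows "intertwines G A \<sigma> \<alpha> x e f"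
  unfolding intertwines_def
proof (intro ballI)
  fix r g assume rg: "r \<in> hom_set G f e" "g \<in> hom_set G f e"
  then have r: "r \<in> Mor G" "Dom G r = e" "Cod G r = f" and g: "g \<in> Mor G" "Cod G g = f"
    by (simp_all add: hom_set_def)
  interpret R: ring "A f" using ring_Cod[OF g(1)] by (simp add: g)
  have xC: "x \<in> carrier CP"
    using x by (simp add: center_def)
  let ?L = "{t \<in> hom_set G f f. t \<cdot> r = g}" and ?R = "{s \<in> hom_set G e e. r \<cdot> s = g}"
  have "fsum (A f) (\<lambda>s. \<sigma> r (x s) \<otimes>\<^bsub>A f\<^esub> \<alpha> r s) ?R
      = fsum (A f) (\<lambda>s. \<one>\<^bsub>A f\<^esub> \<otimes>\<^bsub>A f\<^esub> \<sigma> r (x s) \<otimes>\<^bsub>A f\<^esub> \<alpha> r s) ?R"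
  proof (rule fsum_cong[OF R.abelian_monoid_axioms refl])
    fix s assume "s \<in> ?R"
    then have s: "s \<in> Mor G" "Cod G s = e" "(r, s) \<in> composable G"
      using r by (auto simp: hom_set_def composable_def)
    have "\<sigma> r (x s) \<in> carrier (A f)" "\<alpha> r s \<in> carrier (A f)"
      using r s coeff_closed[OF xC, of s] \<sigma>_closed[of r "x s"] \<alpha>_closed[of r s] by simp_all
    then show "\<sigma> r (x s) \<otimes>\<^bsub>A f\<^esub> \<alpha> r s = \<one>\<^bsub>A f\<^esub> \<otimes>\<^bsub>A f\<^esub> \<sigma> r (x s) \<otimes>\<^bsub>A f\<^esub> \<alpha> r s"
      "\<one>\<^bsub>A f\<^esub> \<otimes>\<^bsub>A f\<^esub> \<sigma> r (x s) \<otimes>\<^bsub>A f\<^esub> \<alpha> r s \<in> carrier (A f)"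
      by simp_all
  qed
  also have "\<dots> = fsum (A f) (\<lambda>s. x s \<otimes>\<^bsub>A f\<^esub> \<sigma> s \<one>\<^bsub>A f\<^esub> \<otimes>\<^bsub>A f\<^esub> \<alpha> s r) ?L"
    using center_monomial[OF x r(1) _ g(1), of "\<one>\<^bsub>A f\<^esub>"]
    unfolding composable_parallel_left[OF rg] composable_parallel_right[OF rg] by (simp add: r g)
  also have "\<dots> = fsum (A f) (\<lambda>t. x t \<otimes>\<^bsub>A f\<^esub> \<alpha> t r) ?L"
  proof (rule fsum_cong[OF R.abelian_monoid_axioms refl])
    fix s assume "s \<in> ?L"
    then have s: "s \<in> Mor G" "Cod G s = f" "Dom G s = f" "(s, r) \<in> composable G"
      using r by (auto simp: hom_set_def composable_def)
    have "x s \<in> carrier (A f)" "\<alpha> s r \<in> carrier (A f)" "\<sigma> s \<one>\<^bsub>A f\<^esub> = \<one>\<^bsub>A f\<^esub>"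
      using s coeff_closed[OF xC, of s] \<alpha>_closed[of s r] \<sigma>_one[of s] by simp_all
    then show "x s \<otimes>\<^bsub>A f\<^esub> \<sigma> s \<one>\<^bsub>A f\<^esub> \<otimes>\<^bsub>A f\<^esub> \<alpha> s r = x s \<otimes>\<^bsub>A f\<^esub> \<alpha> s r"
      "x s \<otimes>\<^bsub>A f\<^esub> \<alpha> s r \<in> carrier (A f)"
      by simp_all
  qed
  finally show "fsum (A f) (\<lambda>s. \<sigma> r (x s) \<otimes>\<^bsub>A f\<^esub> \<alpha> r s) ?R = fsum (A f) (\<lambda>t. x t \<otimes>\<^bsub>A f\<^esub> \<alpha> t r) ?L" .
qed

lemma center_iff:
  "x \<in> center CP \<longleftrightarrow> x \<in> carrier CP \<and> commutes_with_base G A \<sigma> x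
    \<and> (\<forall>e \<in> Ob G. \<forall>f \<in> Ob G. intertwines G A \<sigma> \<alpha> x e f)"
  using center_commutes_with_base center_intertwines mem_center by (auto simp: center_def)

text \<open>The condition for \<open>e\<close> and \<open>f\<close> sees only the local parts of \<open>x\<close> at \<open>e\<close> and \<open>f\<close>, so for \<open>e = f\<close> it can
  be moved between an element and its local part.\<close>

lemma intertwines_cong:
  assumes y: "y \<in> carrier CP" and ef: "f \<in> Ob G"
    and eq: "\<And>s. s \<in> hom_set G e e \<union> hom_set G f f \<Longrightarrow> x s = y s"
  shows "intertwines G A \<sigma> \<alpha> x e f = intertwines G A \<sigma> \<alpha> y e f"
proof -
  interpret R: ring "A f" using ef by (rule ring_A)
  have "fsum (A f) (\<lambda>s. \<sigma> r (x s) \<otimes>\<^bsub>A f\<^esub> \<alpha> r s) {s \<in> hom_set G e e. r \<cdot> s = g}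
      = fsum (A f) (\<lambda>s. \<sigma> r (y s) \<otimes>\<^bsub>A f\<^esub> \<alpha> r s) {s \<in> hom_set G e e. r \<cdot> s = g}"
    (is "?l = ?l'")
    and "fsum (A f) (\<lambda>t. x t \<otimes>\<^bsub>A f\<^esub> \<alpha> t r) {t \<in> hom_set G f f. t \<cdot> r = g}
      = fsum (A f) (\<lambda>t. y t \<otimes>\<^bsub>A f\<^esub> \<alpha> t r) {t \<in> hom_set G f f. t \<cdot> r = g}"
    (is "?r = ?r'")
    if r: "r \<in> hom_set G f e" for r g
  proof -
    have "\<sigma> r (y s) \<in> carrier (A f)" "\<alpha> r s \<in> carrier (A f)" if "s \<in> hom_set G e e" for s
      using that r coeff_closed[OF y, of s] \<sigma>_closed[of r "y s"] \<alpha>_closed[of r s]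
      by (simp_all add: hom_set_def composable_def)
    then show "?l = ?l'"
      using eq by (intro fsum_cong[OF R.abelian_monoid_axioms refl]) auto
    have "y t \<in> carrier (A f)" "\<alpha> t r \<in> carrier (A f)" if "t \<in> hom_set G f f" for t
      using that r coeff_closed[OF y, of t] \<alpha>_closed[of t r]
      by (auto simp: hom_set_def composable_def)
    then show "?r = ?r'"
      using eq by (intro fsum_cong[OF R.abelian_monoid_axioms refl]) auto
  qed
  then show ?thesis
    by (simp add: intertwines_def)
qed

section \<open>The local crossed products\<close>

lemma carrier_endo:
  "z \<in> carrier (crossed_product (endo G e) A \<sigma> \<alpha>) \<longleftrightarrow>
    z \<in> carrier CP \<and> (\<forall>s. s \<notin> hom_set G e e \<longrightarrow> z s = \<zero>\<^bsub>A (Cod G s)\<^esub>)"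
  (is "?l \<longleftrightarrow> ?r")
proof
  show "?l \<Longrightarrow> ?r"
    using carrier_crossed_product_endo_subset[OF crossed_system_axioms, of e]
    by (auto simp: crossed_product_def Mor_endo)
  assume r: ?r
  then have "finite {s \<in> Mor G. z s \<noteq> \<zero>\<^bsub>A (Cod G s)\<^esub>}"
    by (simp add: carrier_CP)
  then have "finite {s \<in> hom_set G e e. z s \<noteq> \<zero>\<^bsub>A (Cod G s)\<^esub>}"
    by (rule finite_subset[rotated]) (auto simp: hom_set_def)
  then show ?l
    using r by (auto simp: crossed_product_def Mor_endo) (auto simp: hom_set_def)
qed

text \<open>This is \<open>center_iff\<close> for the crossed system over \<open>endo G e\<close>, whose only object is \<open>e\<close> and whose
  morphisms are all endomorphisms.\<close>

lemma center_endo_iff: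
  assumes e: "e \<in> Ob G"
  shows "z \<in> center (crossed_product (endo G e) A \<sigma> \<alpha>) \<longleftrightarrow>
    z \<in> carrier (crossed_product (endo G e) A \<sigma> \<alpha>)
    \<and> (\<forall>s \<in> hom_set G e e. \<forall>b \<in> carrier (A e). z s \<otimes>\<^bsub>A e\<^esub> \<sigma> s b = b \<otimes>\<^bsub>A e\<^esub> z s)
    \<and> intertwines G A \<sigma> \<alpha> z e e"
proof -
  have E: "crossed_system (endo G e) A \<sigma> \<alpha>"
    using crossed_system_axioms e by (rule crossed_system_endo)
  have hom: "hom_set (endo G e) e e = hom_set G e e"
    by (auto simp: hom_set_def endo_def)
  have "e \<in> hom_set G e e"
    using e by (auto simp: Ob_iff hom_set_def)
  then have Ob: "Ob (endo G e) = {e}"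
    by (auto simp: Ob_def Mor_endo hom_set_def image_iff)
  have "commutes_with_base (endo G e) A \<sigma> z \<longleftrightarrow>
      (\<forall>s \<in> hom_set G e e. \<forall>b \<in> carrier (A e). z s \<otimes>\<^bsub>A e\<^esub> \<sigma> s b = b \<otimes>\<^bsub>A e\<^esub> z s)"
    by (auto simp: commutes_with_base_def Mor_endo hom_set_def)
  moreover have "intertwines (endo G e) A \<sigma> \<alpha> z e e = intertwines G A \<sigma> \<alpha> z e e"
    by (simp add: intertwines_def hom)
  ultimately show ?thesis
    by (simp add: crossed_system.center_iff[OF E] Ob)
qed

text \<open>Elements of different local crossed products have disjoint supports, so at each endomorphism
  of an object \<open>e\<close> the sum just picks the summand for \<open>e\<close>.\<close>

lemma finsum_endo_coeff:
  assumes "finite F" "F \<subseteq> Ob G"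
    and "\<And>e. e \<in> F \<Longrightarrow> z e \<in> carrier (crossed_product (endo G e) A \<sigma> \<alpha>)"
  shows "finsum CP z F = (\<lambda>s. if s \<in> Mor G \<and> Dom G s = Cod G s \<and> Cod G s \<in> F
    then z (Cod G s) s else \<zero>\<^bsub>A (Cod G s)\<^esub>)"
  using assms
proof (induction F rule: finite_induct)
  case empty
  interpret abelian_monoid CP by (rule abelian_monoid_CP)
  show ?case
    by (simp only: finsum_empty) (simp add: zero_CP)
next
  case (insert e F)
  interpret abelian_monoid CP by (rule abelian_monoid_CP)
  have z: "z f \<in> carrier CP" if "f \<in> insert e F" for f
    using insert.prems(2)[OF that] by (simp add: carrier_endo)
  have out: "z e s = \<zero>\<^bsub>A (Cod G s)\<^esub>" if "s \<notin> hom_set G e e" for s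
    using insert.prems(2)[of e] that by (simp add: carrier_endo)
  have sum: "finsum CP z (insert e F) = z e \<oplus>\<^bsub>CP\<^esub> finsum CP z F"
    using insert.hyps z by (intro finsum_insert) auto
  have IH: "finsum CP z F = (\<lambda>s. if s \<in> Mor G \<and> Dom G s = Cod G s \<and> Cod G s \<in> F
      then z (Cod G s) s else \<zero>\<^bsub>A (Cod G s)\<^esub>)"
    using insert by simp
  show ?case
  proof
    fix s
    show "finsum CP z (insert e F) s = (if s \<in> Mor G \<and> Dom G s = Cod G s \<and> Cod G s \<in> insert e F
      then z (Cod G s) s else \<zero>\<^bsub>A (Cod G s)\<^esub>)"
    proof (cases "s \<in> Mor G")
      case True
      then interpret R: ring "A (Cod G s)" by (rule ring_Cod)
      have zs: "z f s \<in> carrier (A (Cod G s))" if "f \<in> insert e F" for f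
        using z[OF that] True by (rule coeff_closed)
      show ?thesis
      proof (cases "s \<in> hom_set G e e")
        case s: True
        then show ?thesis
          using True insert.hyps zs[of e] by (auto simp: sum add_CP IH hom_set_def)
      next
        case False
        then show ?thesis
          using True zs out[OF False] by (auto simp: sum add_CP IH hom_set_def)
      qed
    qed (simp add: sum add_CP)
  qed
qed

lemma fsum_endo_coeff:
  assumes z: "\<And>e. e \<in> Ob G \<Longrightarrow> z e \<in> carrier (crossed_product (endo G e) A \<sigma> \<alpha>)"
    and fin: "finite {e \<in> Ob G. z e \<noteq> \<zero>\<^bsub>CP\<^esub>}"
  shows "fsum CP z (Ob G) = (\<lambda>s. if s \<in> Mor G \<and> Dom G s = Cod G s
    then z (Cod G s) s else \<zero>\<^bsub>A (Cod G s)\<^esub>)"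
proof
  fix s
  have "fsum CP z (Ob G) s = (if s \<in> Mor G \<and> Dom G s = Cod G s \<and> Cod G s \<in> {e \<in> Ob G. z e \<noteq> \<zero>\<^bsub>CP\<^esub>}
      then z (Cod G s) s else \<zero>\<^bsub>A (Cod G s)\<^esub>)"
    unfolding fsum_def by (subst finsum_endo_coeff[OF fin]) (use z in auto)
  also have "\<dots> = (if s \<in> Mor G \<and> Dom G s = Cod G s then z (Cod G s) s else \<zero>\<^bsub>A (Cod G s)\<^esub>)"
    by (auto simp: Cod_Ob zero_CP)
  finally show "fsum CP z (Ob G) s
    = (if s \<in> Mor G \<and> Dom G s = Cod G s then z (Cod G s) s else \<zero>\<^bsub>A (Cod G s)\<^esub>)" .
qed

text \<open>By \<open>center_iff\<close> and \<open>center_endo_iff\<close> both sides impose the same conditions on coefficients. The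
  local part of \<open>a\<close> at \<open>e\<close> is its restriction to the endomorphisms of \<open>e\<close>; only finitely many of
  these are nonzero because \<open>a\<close> has finite support.\<close>

lemma center_eq:
  "center CP = {a \<in> sum_of_sets CP (\<lambda>e. center (crossed_product (endo G e) A \<sigma> \<alpha>)) (Ob G).
    \<forall>e \<in> Ob G. \<forall>f \<in> Ob G. e \<noteq> f \<longrightarrow> intertwines G A \<sigma> \<alpha> a e f}"
  (is "_ = {a \<in> ?S. ?I a}")
proof (intro equalityI subsetI)
  fix a assume a: "a \<in> center CP"
  then have aC: "a \<in> carrier CP" and base: "commutes_with_base G A \<sigma> a"
    and inter: "\<And>e f. \<lbrakk>e \<in> Ob G; f \<in> Ob G\<rbrakk> \<Longrightarrow> intertwines G A \<sigma> \<alpha> a e f"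
    by (simp_all add: center_iff)
  define z where "z e s = (if s \<in> hom_set G e e then a s else \<zero>\<^bsub>A (Cod G s)\<^esub>)" for e s
  have fina: "finite {s \<in> Mor G. a s \<noteq> \<zero>\<^bsub>A (Cod G s)\<^esub>}"
    using aC by (simp add: carrier_CP)
  have zE: "z e \<in> carrier (crossed_product (endo G e) A \<sigma> \<alpha>)" if "e \<in> Ob G" for e
  proof -
    have "finite {s \<in> Mor G. z e s \<noteq> \<zero>\<^bsub>A (Cod G s)\<^esub>}"
      by (rule finite_subset[OF _ fina]) (auto simp: z_def)
    then have "z e \<in> carrier CP"
      using aC ring.ring_simprules(2)[OF ring_Cod] by (auto simp: carrier_CP z_def hom_set_def)
    then show ?thesis
      by (simp add: carrier_endo z_def)
  qed
  have zZ: "z e \<in> center (crossed_product (endo G e) A \<sigma> \<alpha>)" if e: "e \<in> Ob G" for e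
  proof -
    have "intertwines G A \<sigma> \<alpha> (z e) e e"
      using inter[OF e e] intertwines_cong[OF aC e, of e "z e"] by (simp add: z_def)
    then show ?thesis
      using base zE[OF e] by (auto simp: center_endo_iff[OF e] z_def commutes_with_base_def hom_set_def)
  qed
  have finz: "finite {e \<in> Ob G. z e \<noteq> \<zero>\<^bsub>CP\<^esub>}"
  proof (rule finite_subset)
    show "{e \<in> Ob G. z e \<noteq> \<zero>\<^bsub>CP\<^esub>} \<subseteq> Cod G ` {s \<in> Mor G. a s \<noteq> \<zero>\<^bsub>A (Cod G s)\<^esub>}"
    proof
      fix e assume "e \<in> {e \<in> Ob G. z e \<noteq> \<zero>\<^bsub>CP\<^esub>}"
      then obtain s where "z e s \<noteq> \<zero>\<^bsub>A (Cod G s)\<^esub>"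
        by (auto simp: zero_CP fun_eq_iff)
      then have "s \<in> hom_set G e e" "a s \<noteq> \<zero>\<^bsub>A (Cod G s)\<^esub>"
        by (auto simp: z_def split: if_splits)
      then show "e \<in> Cod G ` {s \<in> Mor G. a s \<noteq> \<zero>\<^bsub>A (Cod G s)\<^esub>}"
        by (auto simp: hom_set_def)
    qed
  qed (use fina in simp)
  have "fsum CP z (Ob G) = a"
  proof
    fix s
    show "fsum CP z (Ob G) s = a s"
      using base aC by (cases "s \<in> Mor G")
        (auto simp: fsum_endo_coeff[OF zE finz] z_def hom_set_def commutes_with_base_def carrier_CP)
  qed
  then have "a \<in> ?S"
    using zZ finz unfolding sum_of_sets_def by blast
  then show "a \<in> {a \<in> ?S. ?I a}"
    using inter by blast
next
  fix a assume "a \<in> {a \<in> ?S. ?I a}"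
  then obtain z where a: "a = fsum CP z (Ob G)" and inter: "?I a"
    and zZ: "\<And>e. e \<in> Ob G \<Longrightarrow> z e \<in> center (crossed_product (endo G e) A \<sigma> \<alpha>)"
    and finz: "finite {e \<in> Ob G. z e \<noteq> \<zero>\<^bsub>CP\<^esub>}"
    unfolding sum_of_sets_def by blast
  have zE: "z e \<in> carrier (crossed_product (endo G e) A \<sigma> \<alpha>)" if "e \<in> Ob G" for e
    using zZ[OF that] by (simp add: center_def)
  then have zC: "z e \<in> carrier CP" if "e \<in> Ob G" for e
    using that by (simp add: carrier_endo)
  have coeff: "a s = (if s \<in> Mor G \<and> Dom G s = Cod G s then z (Cod G s) s else \<zero>\<^bsub>A (Cod G s)\<^esub>)" for s
    unfolding a by (rule fun_cong[OF fsum_endo_coeff[OF zE finz]])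
  have "a \<in> carrier CP"
    unfolding a using abelian_monoid_CP zC by (rule abelian_monoid.fsum_closed)
  moreover have "commutes_with_base G A \<sigma> a"
    unfolding commutes_with_base_def
  proof
    fix s assume s: "s \<in> Mor G"
    have "z (Cod G s) s \<otimes>\<^bsub>A (Cod G s)\<^esub> \<sigma> s b = b \<otimes>\<^bsub>A (Cod G s)\<^esub> z (Cod G s) s"
      if "Dom G s = Cod G s" "b \<in> carrier (A (Cod G s))" for b
      using zZ[OF Cod_Ob[OF s]] s that by (auto simp: center_endo_iff[OF Cod_Ob[OF s]] hom_set_def)
    then show "if Dom G s = Cod G s
      then \<forall>b \<in> carrier (A (Cod G s)). a s \<otimes>\<^bsub>A (Cod G s)\<^esub> \<sigma> s b = b \<otimes>\<^bsub>A (Cod G s)\<^esub> a s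
      else a s = \<zero>\<^bsub>A (Cod G s)\<^esub>"
      using s by (simp add: coeff)
  qed
  moreover have "intertwines G A \<sigma> \<alpha> a e f" if e: "e \<in> Ob G" and f: "f \<in> Ob G" for e f
  proof (cases "e = f")
    case True
    have "intertwines G A \<sigma> \<alpha> a e e = intertwines G A \<sigma> \<alpha> (z e) e e"
      by (rule intertwines_cong[OF zC[OF e] e]) (auto simp: coeff hom_set_def)
    then show ?thesis
      using zZ[OF e] unfolding center_endo_iff[OF e] True[symmetric] by blast
  qed (use inter e f in blast)
  ultimately show "a \<in> center CP"
    by (simp add: center_iff)
qed

end

theorem proposition2:
  fixes G :: "('s, 'm) small_cat_scheme"
    and A :: "'s \<Rightarrow> ('a, 'n) ring_scheme"
    and \<sigma> :: "'s \<Rightarrow> 'a \<Rightarrow> 'a"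
    and \<alpha> :: "'s \<Rightarrow> 's \<Rightarrow> 'a"
  assumes "crossed_system G A \<sigma> \<alpha>"
  shows "center (crossed_product G A \<sigma> \<alpha>) =
    {a \<in> sum_of_sets (crossed_product G A \<sigma> \<alpha>)
           (\<lambda>e. center (crossed_product (endo G e) A \<sigma> \<alpha>)) (Ob G).
      \<forall>e \<in> Ob G. \<forall>f \<in> Ob G. e \<noteq> f \<longrightarrow>
        (\<forall>r \<in> hom_set G f e. \<forall>g \<in> hom_set G f e.
          fsum (A f) (\<lambda>s. \<sigma> r (a s) \<otimes>\<^bsub>A f\<^esub> \<alpha> r s) {s \<in> hom_set G e e. r \<cdot>\<^bsub>G\<^esub> s = g} =
          fsum (A f) (\<lambda>t. a t \<otimes>\<^bsub>A f\<^esub> \<alpha> t r) {t \<in> hom_set G f f. t \<cdot>\<^bsub>G\<^esub> r = g})}"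
  using crossed_system.center_eq[OF assms] unfolding intertwines_def .

end
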